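(* Assume $0 < \epsilon \leq \frac{c \cdot \pi_0 - z^*}{c \cdot e - z^*}$ (where $\epsilon$ is the accuracy input to Algorithm 2 and $\pi_0 = \pi(\bar{x})$). For the iterates of Algorithm 2, $$\ell \geq 8\,(M\,\mathrm{Dist}_{c \cdot \pi_0})^2 \left( \frac{1}{\epsilon^2} + \frac{1}{\epsilon}\,\log_{4/3}\left(\frac{1-\epsilon}{1 - \frac{c \cdot \pi_0 - z^*}{c \cdot e - z^*}}\right) + 1 \right)$$ implies $$\min_{k \leq \ell} \frac{c \cdot \pi_k - z^*}{c \cdot e - z^*} \leq \epsilon .$$
   Context: $\mathcal{E}$ is a finite-dimensional real Euclidean space with inner product written $u \cdot v$, and $\mathcal{K} \subset \mathcal{E}$ is a proper (meaning $\mathcal{K} \neq \mathcal{E}$; not necessarily pointed) closed convex cone with nonempty interior $\mathrm{int}(\mathcal{K})$. $\mathrm{Affine} \subseteq \mathcal{E}$ is an affine space (a translate of a linear subspace), and $c \in \mathcal{E}$ is not orthogonal to the subspace of which $\mathrm{Affine}$ is a translate. The conic program CP is $$\min\ c \cdot x \quad \text{s.t.} \quad x \in \mathrm{Affine},\ x \in \mathcal{K};$$ it is assumed to have an optimal solution, and $z^*$ denotes its optimal value. The set $\mathrm{Affine} \cap \mathrm{int}(\mathcal{K})$ is assumed nonempty, and $e$ is a fixed point of it. For $z \in \mathbb{R}$, $\mathrm{Affine}_z := \{x \in \mathrm{Affine} : c \cdot x = z\}$; all the nonempty sets $\mathrm{Affine}_z$ are translates of one linear subspace $\mathcal{L}$.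 For $x \in \mathcal{E}$, $$\lambda_{\min}(x) := \inf\{\lambda \in \mathbb{R} : x - \lambda e \notin \mathcal{K}\},$$ a concave function; it is the unique scalar $\lambda$ for which $x - \lambda e$ lies in the boundary of $\mathcal{K}$. For $x$ with $\lambda_{\min}(x) < 1$ (which holds for every $x \in \mathrm{Affine}$ with $c \cdot x < c \cdot e$), $\pi(x) := e + \frac{1}{1-\lambda_{\min}(x)}(x-e)$. A "computational" inner product $\langle\,,\,\rangle$ on $\mathcal{E}$, possibly different from $u \cdot v$, is fixed, with norm $\|\ \|$. A supgradient of $\lambda_{\min}$ at $x$ is a vector $\nabla\lambda_{\min}(x) \in \mathcal{E}$ with $\lambda_{\min}(x) + \langle \nabla\lambda_{\min}(x), v\rangle \geq \lambda_{\min}(x+v)$ for all $v \in \mathcal{E}$; projection onto $\mathcal{L}$ means orthogonal projection with respect to $\langle\,,\,\rangle$. $M$ is the Lipschitz constant $\sup\{|\lambda_{\min}(x) - \lambda_{\min}(y)|/\|x-y\| : x,y \in \mathrm{Affine}_z,\ x \neq y\}$ of $\lambda_{\min}$ restricted to $\mathrm{Affine}_z$, which is finite and independent of $z$ ($M := 0$ if $\mathcal{L} = \{0\}$). For $z < c \cdot e$ and $x \in \mathrm{Affine}_z$, $$\mathrm{dist}_z(x) := \min\{\|x - x_z^*\| : x_z^* \text{ maximizes } \lambda_{\min} \text{ over } \mathrm{Affine}_z\}$$ (the set of maximizers is nonempty). For $z \in \mathbb{R}$, $\mathrm{Level}_z := \mathrm{Affine}_z \cap \mathcal{K}$. For $z^*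 \leq z < c \cdot e$, $$\mathrm{Dist}_z := \sup\{\mathrm{dist}_{z'}(x) : z' \leq z \text{ and } x \in \mathrm{Level}_{z'}\} \in [0,+\infty].$$ Algorithm 2. Input: $0 < \epsilon < 1$; $e$; and $\bar{x} \in \mathrm{Affine}$ with $c \cdot \bar{x} < c \cdot e$. Initialize $x_0 = \pi_0 = \pi(\bar{x})$. For $k = 0,1,2,\ldots$: let $$\tilde{x}_{k+1} := x_k + \frac{\epsilon}{2\|g_k\|^2}\,g_k,$$ where $g_k$ is the projection onto $\mathcal{L}$ of a supgradient $\nabla\lambda_{\min}(x_k)$ (any choice); let $\pi_{k+1} := \pi(\tilde{x}_{k+1})$; if $c \cdot (e - \pi_{k+1}) \geq \frac{4}{3}\,c \cdot (e - \tilde{x}_{k+1})$, let $x_{k+1} = \pi_{k+1}$; otherwise let $x_{k+1} = \tilde{x}_{k+1}$. If $g_k = 0$ (in which case $\pi(x_k)$ is optimal for CP), the step is taken to be zero, i.e. $\tilde{x}_{k+1} = x_k$. The index $\ell$ is a nonnegative integer. *)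

theory Defs
  imports "HOL-Analysis.Analysis"
begin

text \<open>
  The inner product of the class \<open>euclidean_space\<close>, written \<open>c \<bullet> x\<close>, appears only in the objective
  function.  Norms, supgradients and projections
  use a second, arbitrary inner product \<open>ip\<close>.
  Throughout, \<open>K\<close> is the cone, \<open>A\<close> the affine space, \<open>c\<close> the objective and \<open>e\<close> the fixed point of
  \<open>A \<inter> interior K\<close>.
\<close>

definition is_inner_product :: "('a::euclidean_space \<Rightarrow> 'a \<Rightarrow> real) \<Rightarrow> bool" where
  "is_inner_product ip \<longleftrightarrow>
     bilinear ip \<and> (\<forall>u v. ip u v = ip v u) \<and> (\<forall>u. u \<noteq> 0 \<longrightarrow> ip u u > 0)"

definition ip_norm :: "('a::euclidean_space \<Rightarrow> 'a \<Rightarrow> real) \<Rightarrow> 'a \<Rightarrow> real" where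
  "ip_norm ip v = sqrt (ip v v)"

definition affine_direction :: "'a::euclidean_space set \<Rightarrow> 'a set" where
  "affine_direction A = {x - y | x y. x \<in> A \<and> y \<in> A}"

definition is_optimal_solution ::
    "'a::euclidean_space set \<Rightarrow> 'a set \<Rightarrow> 'a \<Rightarrow> 'a \<Rightarrow> bool" where
  "is_optimal_solution K A c x \<longleftrightarrow> x \<in> A \<inter> K \<and> (\<forall>y \<in> A \<inter> K. c \<bullet> x \<le> c \<bullet> y)"

definition optimal_value :: "'a::euclidean_space set \<Rightarrow> 'a set \<Rightarrow> 'a \<Rightarrow> real" where
  "optimal_value K A c = (INF x \<in> A \<inter> K. c \<bullet> x)"

definition affine_slice :: "'a::euclidean_space set \<Rightarrow> 'a \<Rightarrow> real \<Rightarrow> 'a set" where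
  "affine_slice A c z = {x \<in> A. c \<bullet> x = z}"

definition slice_space :: "'a::euclidean_space set \<Rightarrow> 'a \<Rightarrow> 'a set" where
  "slice_space A c = {v \<in> affine_direction A. c \<bullet> v = 0}"

text \<open>Every nonempty slice is indeed a translate of the one subspace \<open>slice_space A c\<close>.\<close>

lemma subspace_affine_direction:
  assumes "affine A" "A \<noteq> {}"
  shows "subspace (affine_direction A)"
proof -
  obtain a where a: "a \<in> A" using assms(2) by blast
  have "affine_direction A = (\<Union>a\<in>A. (\<lambda>x. x - a) ` A)"
    unfolding affine_direction_def by blast
  also have "\<dots> = (\<lambda>x. x - a) ` A"
  proof -
    have "x - b \<in> (\<lambda>x. x - a) ` A" if "x \<in> A" "b \<in> A" for x b
    proof (rule image_eqI[where x = "a + x - b"])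
      show "a + x - b \<in> A"
        using mem_affine_3_minus[OF assms(1) a that, of 1] by (simp add: algebra_simps)
    qed simp
    then show ?thesis using a by blast
  qed
  finally show ?thesis
    using affine_diffs_subspace_subtract[OF assms(1) a] by simp
qed

lemma subspace_slice_space:
  assumes "affine A" "A \<noteq> {}"
  shows "subspace (slice_space A c)"
  using subspace_affine_direction[OF assms]
  unfolding slice_space_def subspace_def by (auto simp: inner_add_right)

lemma affine_slice_translate:
  assumes "affine A" "x \<in> affine_slice A c z"
  shows "affine_slice A c z = (+) x ` slice_space A c"
proof (intro equalityI subsetI)
  fix y assume y: "y \<in> affine_slice A c z"
  then have "y - x \<in> slice_space A c"
    using assms(2) unfolding affine_slice_def slice_space_def affine_direction_def
    by (auto simp: inner_diff_right)
  then show "y \<in> (+) x ` slice_space A c"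
    by (rule image_eqI[rotated]) simp
next
  fix y assume "y \<in> (+) x ` slice_space A c"
  then obtain a b where ab: "a \<in> A" "b \<in> A" "c \<bullet> (a - b) = 0" "y = x + (a - b)"
    unfolding slice_space_def affine_direction_def by auto
  have "y \<in> A"
    using mem_affine_3_minus[of A x a b 1] assms ab unfolding affine_slice_def by simp
  then show "y \<in> affine_slice A c z"
    using assms(2) ab unfolding affine_slice_def by (simp add: inner_add_right)
qed

definition lambda_min :: "'a::euclidean_space set \<Rightarrow> 'a \<Rightarrow> 'a \<Rightarrow> real" where
  "lambda_min K e x = Inf {t. x - t *\<^sub>R e \<notin> K}"

definition radial_proj :: "'a::euclidean_space set \<Rightarrow> 'a \<Rightarrow> 'a \<Rightarrow> 'a" where
  "radial_proj K e x = e + (1 / (1 - lambda_min K e x)) *\<^sub>R (x - e)"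

definition is_supgradient ::
    "'a::euclidean_space set \<Rightarrow> 'a \<Rightarrow> ('a \<Rightarrow> 'a \<Rightarrow> real) \<Rightarrow> 'a \<Rightarrow> 'a \<Rightarrow> bool" where
  "is_supgradient K e ip x s \<longleftrightarrow>
     (\<forall>v. lambda_min K e x + ip s v \<ge> lambda_min K e (x + v))"

definition is_ip_projection ::
    "('a::euclidean_space \<Rightarrow> 'a \<Rightarrow> real) \<Rightarrow> 'a set \<Rightarrow> 'a \<Rightarrow> 'a \<Rightarrow> bool" where
  "is_ip_projection ip L s g \<longleftrightarrow> g \<in> L \<and> (\<forall>v\<in>L. ip (s - g) v = 0)"

text \<open>The value does not depend on \<open>z\<close> under the standing assumptions.\<close>

definition lipschitz_const ::
    "'a::euclidean_space set \<Rightarrow> 'a set \<Rightarrow> 'a \<Rightarrow> 'a \<Rightarrow> ('a \<Rightarrow> 'a \<Rightarrow> real) \<Rightarrow> real \<Rightarrow> real" where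
  "lipschitz_const K A c e ip z =
     (if slice_space A c = {0} then 0
      else Sup {\<bar>lambda_min K e x - lambda_min K e y\<bar> / ip_norm ip (x - y) | x y.
                  x \<in> affine_slice A c z \<and> y \<in> affine_slice A c z \<and> x \<noteq> y})"

definition slice_maximizers ::
    "'a::euclidean_space set \<Rightarrow> 'a set \<Rightarrow> 'a \<Rightarrow> 'a \<Rightarrow> real \<Rightarrow> 'a set" where
  "slice_maximizers K A c e z =
     {x \<in> affine_slice A c z. \<forall>y \<in> affine_slice A c z. lambda_min K e y \<le> lambda_min K e x}"

text \<open>
  For \<open>z < c \<bullet> e\<close> the set of maximizers is nonempty and closed, so the infimum is a minimum.
\<close>

definition dist_opt ::
    "'a::euclidean_space set \<Rightarrow> 'a set \<Rightarrow> 'a \<Rightarrow> 'a \<Rightarrow> ('a \<Rightarrow> 'a \<Rightarrow> real) \<Rightarrow> real \<Rightarrow> 'a \<Rightarrow> real" where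
  "dist_opt K A c e ip z x = (INF y \<in> slice_maximizers K A c e z. ip_norm ip (x - y))"

definition level :: "'a::euclidean_space set \<Rightarrow> 'a set \<Rightarrow> 'a \<Rightarrow> real \<Rightarrow> 'a set" where
  "level K A c z = affine_slice A c z \<inter> K"

text \<open>The supremum may be \<open>\<infinity>\<close>, hence the extended reals.\<close>

definition Dist_opt ::
    "'a::euclidean_space set \<Rightarrow> 'a set \<Rightarrow> 'a \<Rightarrow> 'a \<Rightarrow> ('a \<Rightarrow> 'a \<Rightarrow> real) \<Rightarrow> real \<Rightarrow> ereal" where
  "Dist_opt K A c e ip z =
     Sup {ereal (dist_opt K A c e ip z' x) | z' x. z' \<le> z \<and> x \<in> level K A c z'}"

text \<open>
  \<open>x\<close>, \<open>xt\<close>, \<open>p\<close>, \<open>g\<close> are the sequences of the iterates, the points with a tilde, the projections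
  \<open>\<pi>\<^sub>k\<close> and the projected supgradients of a run; \<open>xt 0\<close> plays no role.
  The choice of supgradients is nondeterministic.
\<close>

definition is_algorithm2_run ::
    "'a::euclidean_space set \<Rightarrow> 'a set \<Rightarrow> 'a \<Rightarrow> 'a \<Rightarrow> ('a \<Rightarrow> 'a \<Rightarrow> real) \<Rightarrow> real \<Rightarrow> 'a \<Rightarrow>
     (nat \<Rightarrow> 'a) \<Rightarrow> (nat \<Rightarrow> 'a) \<Rightarrow> (nat \<Rightarrow> 'a) \<Rightarrow> (nat \<Rightarrow> 'a) \<Rightarrow> bool" where
  "is_algorithm2_run K A c e ip \<epsilon> xbar x xt p g \<longleftrightarrow>
     p 0 = radial_proj K e xbar \<and> x 0 = p 0 \<and>
     (\<forall>k.
        (\<exists>s. is_supgradient K e ip (x k) s \<and> is_ip_projection ip (slice_space A c) s (g k)) \<and>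
        xt (Suc k) =
          (if g k = 0 then x k else x k + (\<epsilon> / (2 * (ip_norm ip (g k))\<^sup>2)) *\<^sub>R g k) \<and>
        p (Suc k) = radial_proj K e (xt (Suc k)) \<and>
        x (Suc k) =
          (if c \<bullet> (e - p (Suc k)) \<ge> 4 / 3 * (c \<bullet> (e - xt (Suc k))) then p (Suc k)
           else xt (Suc k)))"

end

theory Submission
  imports Defs
begin

text \<open>
  Write \<open>\<lambda>\<close> for \<open>lambda_min K e\<close>. It is superadditive, positively homogeneous and satisfies
  \<open>\<lambda> (x + t e) = \<lambda> x + t\<close>, and \<open>K\<close> is the set where it is nonnegative. Measure a point \<open>x\<close> of the affine
  space by the fraction \<open>s = (c \<bullet> e - c \<bullet> x) / (c \<bullet> e - zstar)\<close> of the possible descent from \<open>e\<close> that it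
  realises (\<open>rel_descent\<close>). Sliding an optimal solution along the ray from \<open>e\<close> into the slice of \<open>x\<close>, and
  projecting the points of the slice radially from \<open>e\<close> to the boundary of \<open>K\<close>, shows that the
  maximum of \<open>\<lambda>\<close> over the slice is exactly \<open>1 - s\<close>, and that the radial projection of \<open>x\<close> has relative
  error above \<open>\<epsilon>\<close> iff \<open>\<epsilon> (1 - \<lambda> x) < (1 - s) - \<lambda> x\<close> (\<open>rel_error_radial_proj\<close>). Inaccuracy is thus a gap
  for the maximization of \<open>\<lambda>\<close> over a slice.

  Suppose that all of \<open>p 0, \<dots>, p l\<close> have error above \<open>\<epsilon>\<close>. A step that stays in its slice is a
  supgradient ascent step: because of the gap, it lowers the squared distance to the maximizers by at
  least \<open>\<epsilon> / M\<^sup>2\<close> times a gain of at least \<open>max (3/4 - s - \<epsilon>/4) (\<epsilon>/2)\<close> (\<open>dist_opt_step\<close>, \<open>step_gain_le\<close>).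
  The first bound holds because an iterate that is not replaced by its radial projection has
  \<open>\<lambda> < 1/4\<close>, and a radial projection has \<open>\<lambda> = 0\<close>. A step that moves to the radial projection restarts the argument in a new slice,
  at squared distance at most the square of \<open>Dist_opt\<close>, and multiplies \<open>s\<close> by at least \<open>4/3\<close>.

  Since \<open>s \<le> 1 - \<epsilon>\<close> at every start of a stretch, there are at most \<open>log\<^bsub>4/3\<^esub> ((1 - \<epsilon>) / s\<^sub>0)\<close> restarts, and
  at most two stretches have \<open>s > 9/16 (1 - \<epsilon>)\<close>. Only these two can take a number of steps of order
  \<open>1 / \<epsilon>\<^sup>2\<close>; in all others the gain is bounded below by a constant, so that they take a number of steps
  of order \<open>1 / \<epsilon>\<close>. Summing up (\<open>restart_count\<close>) contradicts the lower bound on \<open>l\<close>.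
\<close>

section \<open>The concave function of a cone with an interior point\<close>

locale cone_with_interior_point =
  fixes K :: "'a::euclidean_space set" and e :: 'a
  assumes K_closed: "closed K" and K_cone: "convex_cone K" and K_proper: "K \<noteq> UNIV"
    and e_interior: "e \<in> interior K"
begin

lemma K_add: "u \<in> K \<Longrightarrow> v \<in> K \<Longrightarrow> u + v \<in> K"
  by (rule convex_cone_add[OF K_cone])

lemma K_scaleR: "u \<in> K \<Longrightarrow> 0 \<le> t \<Longrightarrow> t *\<^sub>R u \<in> K"
  by (rule convex_cone_scaleR[OF K_cone])

lemma e_in_K: "e \<in> K"
  using e_interior interior_subset by blast

text \<open>A ball around \<open>e\<close> lies in \<open>K\<close>, and \<open>K\<close> absorbs scaling.\<close>
lemma add_large_multiple_mem: "\<exists>C>0. \<forall>v. v + (C * norm v) *\<^sub>R e \<in> K"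
proof -
  obtain r where r: "0 < r" "cball e r \<subseteq> K"
    using e_interior mem_interior_cball by blast
  have "v + (1 / r * norm v) *\<^sub>R e \<in> K" for v
  proof (cases "v = 0")
    case True
    then show ?thesis using K_scaleR[OF e_in_K, of 0] by simp
  next
    case False
    have "e + (r / norm v) *\<^sub>R v \<in> K"
      using r False by (intro subsetD[OF r(2)]) (simp add: dist_norm)
    from K_scaleR[OF this, of "norm v / r"] show ?thesis
      using r False by (simp add: scaleR_add_right add.commute)
  qed
  then show ?thesis using r(1) by (intro exI[of _ "1 / r"]) auto
qed

text \<open>Otherwise the multiples of \<open>e\<close> in the previous lemma could be cancelled, and \<open>K\<close> would be everything.\<close>
lemma minus_e_notin_K: "- e \<notin> K"
proof
  assume neg: "- e \<in> K"
  obtain C where C: "\<And>v. v + (C * norm v) *\<^sub>R e \<in> K" "0 < C"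
    using add_large_multiple_mem by blast
  have "v \<in> K" for v
    using K_add[OF C(1)[of v] K_scaleR[OF neg, of "C * norm v"]] C(2) by simp
  then show False using K_proper by blast
qed

text \<open>
  All later properties of \<open>lambda_min\<close> come from this Galois connection. The parameters \<open>t\<close> with
  \<open>x - t e \<in> K\<close> form a closed down-set. It is not empty because a large multiple of \<open>e\<close> pushes \<open>x\<close> into
  \<open>K\<close>, and it is not the whole line because otherwise \<open>- e\<close>, the limit of \<open>(x - n e) / n\<close>, would be in \<open>K\<close>.
\<close>
lemma lambda_min_ge_iff: "t \<le> lambda_min K e x \<longleftrightarrow> x - t *\<^sub>R e \<in> K"
proof -
  let ?S = "{t. x - t *\<^sub>R e \<notin> K}"
  have down: "x - t' *\<^sub>R e \<in> K" if "x - t *\<^sub>R e \<in> K" "t' \<le> t" for t t'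
    using K_add[OF that(1) K_scaleR[OF e_in_K, of "t - t'"]] that(2)
    by (simp add: algebra_simps)
  obtain C where C: "\<And>v. v + (C * norm v) *\<^sub>R e \<in> K"
    using add_large_multiple_mem by blast
  have bdd: "bdd_below ?S"
  proof (rule bdd_belowI)
    fix t assume "t \<in> ?S"
    then show "- (C * norm x) \<le> t"
      using down[of "- (C * norm x)" t] C[of x] by force
  qed
  have ne: "?S \<noteq> {}"
  proof
    assume "?S = {}"
    then have all: "x - t *\<^sub>R e \<in> K" for t by blast
    have "(\<lambda>n. (1 / real (Suc n)) *\<^sub>R x - e) \<longlonglongrightarrow> 0 *\<^sub>R x - e"
      by (intro tendsto_intros LIMSEQ_Suc[OF lim_1_over_n])
    moreover have "(1 / real (Suc n)) *\<^sub>R x - e \<in> K" for n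
      using K_scaleR[OF all[of "real (Suc n)"], of "1 / real (Suc n)"]
      by (simp add: scaleR_diff_right)
    ultimately have "0 *\<^sub>R x - e \<in> K"
      by (rule closed_sequentially[OF K_closed, rotated])
    then show False using minus_e_notin_K by simp
  qed
  show ?thesis
  proof
    assume t: "t \<le> lambda_min K e x"
    have mem: "x - t' *\<^sub>R e \<in> K" if "t' < t" for t'
    proof (rule ccontr)
      assume "x - t' *\<^sub>R e \<notin> K"
      then have "lambda_min K e x \<le> t'"
        unfolding lambda_min_def by (intro cInf_lower[OF _ bdd]) simp
      then show False using that t by linarith
    qed
    have "(\<lambda>n. x - (t - 1 / real (Suc n)) *\<^sub>R e) \<longlonglongrightarrow> x - (t - 0) *\<^sub>R e"
      by (intro tendsto_intros LIMSEQ_Suc[OF lim_1_over_n])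
    moreover have "x - (t - 1 / real (Suc n)) *\<^sub>R e \<in> K" for n
      by (intro mem) simp
    ultimately have "x - (t - 0) *\<^sub>R e \<in> K"
      by (rule closed_sequentially[OF K_closed, rotated])
    then show "x - t *\<^sub>R e \<in> K" by simp
  next
    assume "x - t *\<^sub>R e \<in> K"
    then show "t \<le> lambda_min K e x"
      unfolding lambda_min_def
    proof (intro cInf_greatest[OF ne])
      fix t' assume "t' \<in> ?S"
      then show "t \<le> t'"
        using down[OF \<open>x - t *\<^sub>R e \<in> K\<close>, of t'] by (cases "t' \<le> t") auto
    qed
  qed
qed

lemma mem_K_iff: "x \<in> K \<longleftrightarrow> 0 \<le> lambda_min K e x"
  using lambda_min_ge_iff[of 0 x] by simp

lemma minus_lambda_min_mem: "x - lambda_min K e x *\<^sub>R e \<in> K"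
  using lambda_min_ge_iff[of "lambda_min K e x" x] by simp

lemma lambda_min_superadditive:
  "lambda_min K e u + lambda_min K e v \<le> lambda_min K e (u + v)"
  using K_add[OF minus_lambda_min_mem[of u] minus_lambda_min_mem[of v]]
  by (simp add: lambda_min_ge_iff algebra_simps)

lemma lambda_min_add_e: "lambda_min K e (x + t *\<^sub>R e) = lambda_min K e x + t"
proof (rule antisym)
  show "lambda_min K e (x + t *\<^sub>R e) \<le> lambda_min K e x + t"
    using minus_lambda_min_mem[of "x + t *\<^sub>R e"]
      lambda_min_ge_iff[of "lambda_min K e (x + t *\<^sub>R e) - t" x]
    by (simp add: algebra_simps)
  show "lambda_min K e x + t \<le> lambda_min K e (x + t *\<^sub>R e)"
    using minus_lambda_min_mem[of x]
    by (simp add: lambda_min_ge_iff algebra_simps)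
qed

lemma lambda_min_scaleR:
  assumes "0 < t"
  shows "lambda_min K e (t *\<^sub>R x) = t * lambda_min K e x"
proof -
  have ge: "r * lambda_min K e y \<le> lambda_min K e (r *\<^sub>R y)" if "0 < r" for r y
    using K_scaleR[OF minus_lambda_min_mem[of y], of r] that
    by (simp add: lambda_min_ge_iff scaleR_diff_right)
  show ?thesis
    using ge[OF assms, of x] ge[of "1 / t" "t *\<^sub>R x"] assms by (simp add: field_simps)
qed

text \<open>
  On a ray from \<open>e\<close> the quantity \<open>1 - lambda_min\<close> is proportional to the distance from \<open>e\<close>; this makes
  the radial projection computable.
\<close>
lemma lambda_min_segment:
  assumes "0 < t"
  shows "lambda_min K e (e + t *\<^sub>R (x - e)) = 1 - t * (1 - lambda_min K e x)"
proof -
  have "e + t *\<^sub>R (x - e) = t *\<^sub>R x + (1 - t) *\<^sub>R e" by (simp add: algebra_simps)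
  then show ?thesis
    by (simp only: lambda_min_add_e lambda_min_scaleR[OF assms]) (simp add: algebra_simps)
qed

lemma lambda_min_lipschitz:
  "\<exists>C>0. \<forall>x y. \<bar>lambda_min K e x - lambda_min K e y\<bar> \<le> C * norm (x - y)"
proof -
  obtain C where C: "0 < C" "\<And>v. v + (C * norm v) *\<^sub>R e \<in> K"
    using add_large_multiple_mem by blast
  have low: "- (C * norm v) \<le> lambda_min K e v" for v
    using C(2)[of v] by (simp add: lambda_min_ge_iff)
  have "\<bar>lambda_min K e x - lambda_min K e y\<bar> \<le> C * norm (x - y)" for x y
    using lambda_min_superadditive[of x "y - x"] lambda_min_superadditive[of y "x - y"]
      low[of "y - x"] low[of "x - y"] by (simp add: norm_minus_commute)
  then show ?thesis using C(1) by blast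
qed

lemma lambda_min_radial_proj:
  assumes "lambda_min K e x < 1"
  shows "lambda_min K e (radial_proj K e x) = 0"
  using assms lambda_min_segment[of "1 / (1 - lambda_min K e x)" x] by (simp add: radial_proj_def)

lemma radial_proj_boundary: "lambda_min K e x = 0 \<Longrightarrow> radial_proj K e x = x"
  by (simp add: radial_proj_def)

end


section \<open>A second inner product on a Euclidean space\<close>

locale inner_prod =
  fixes ip :: "'a::euclidean_space \<Rightarrow> 'a \<Rightarrow> real"
  assumes ip: "is_inner_product ip"
begin

lemma bounded_bilinear_ip: "bounded_bilinear ip"
  using ip by (simp add: is_inner_product_def bilinear_conv_bounded_bilinear)

lemmas ip_simps =
  bounded_bilinear.add_left[OF bounded_bilinear_ip] bounded_bilinear.add_right[OF bounded_bilinear_ip]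
  bounded_bilinear.diff_left[OF bounded_bilinear_ip] bounded_bilinear.diff_right[OF bounded_bilinear_ip]
  bounded_bilinear.scaleR_left[OF bounded_bilinear_ip] bounded_bilinear.scaleR_right[OF bounded_bilinear_ip]
  bounded_bilinear.minus_left[OF bounded_bilinear_ip] bounded_bilinear.minus_right[OF bounded_bilinear_ip]
  bounded_bilinear.zero_left[OF bounded_bilinear_ip] bounded_bilinear.zero_right[OF bounded_bilinear_ip]

lemma ip_sym: "ip u v = ip v u"
  using ip by (simp add: is_inner_product_def)

lemma ip_pos: "u \<noteq> 0 \<Longrightarrow> 0 < ip u u"
  using ip by (simp add: is_inner_product_def)

lemma ip_nonneg: "0 \<le> ip u u"
  using ip_pos[of u] by (cases "u = 0") (auto simp: ip_simps)

lemma ip_norm_sq: "(ip_norm ip v)\<^sup>2 = ip v v"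
  by (simp add: ip_norm_def ip_nonneg)

lemma ip_norm_nonneg: "0 \<le> ip_norm ip v"
  by (simp add: ip_norm_def ip_nonneg)

lemma ip_norm_pos: "v \<noteq> 0 \<Longrightarrow> 0 < ip_norm ip v"
  by (simp add: ip_norm_def ip_pos)

lemma ip_norm_scaleR: "ip_norm ip (t *\<^sub>R v) = \<bar>t\<bar> * ip_norm ip v"
  by (simp add: ip_norm_def ip_simps real_sqrt_mult flip: power2_eq_square mult.assoc)

text \<open>The new norm has a positive minimum on the compact unit sphere.\<close>
lemma norm_le_ip_norm: "\<exists>C>0. \<forall>v. norm v \<le> C * ip_norm ip v"
proof -
  have cont: "continuous_on (sphere 0 1) (\<lambda>v. ip_norm ip v)"
    unfolding ip_norm_def
    by (intro continuous_intros bounded_bilinear.continuous_on[OF bounded_bilinear_ip])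
  obtain b :: 'a where "b \<in> Basis" using nonempty_Basis by blast
  then have "sphere (0::'a) 1 \<noteq> {}" by (auto intro!: exI[of _ b])
  then obtain u where u: "u \<in> sphere 0 1"
    and min: "\<And>v. v \<in> sphere 0 1 \<Longrightarrow> ip_norm ip u \<le> ip_norm ip v"
    using continuous_attains_inf[OF compact_sphere _ cont] by blast
  have "u \<noteq> 0" using u by auto
  then have pos: "0 < ip_norm ip u" by (rule ip_norm_pos)
  have "norm v \<le> 1 / ip_norm ip u * ip_norm ip v" for v
  proof (cases "v = 0")
    case False
    have "ip_norm ip u \<le> ip_norm ip ((1 / norm v) *\<^sub>R v)"
      using False by (intro min) simp
    then show ?thesis using False pos by (simp add: ip_norm_scaleR field_simps)
  qed (simp add: ip_norm_nonneg pos)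
  then show ?thesis using pos by (intro exI[of _ "1 / ip_norm ip u"]) auto
qed

end

section \<open>Slices of a conic program and the ascent step\<close>

locale conic_program =
  cone_with_interior_point K e + inner_prod ip
  for K :: "'a::euclidean_space set" and e :: 'a and ip :: "'a \<Rightarrow> 'a \<Rightarrow> real" +
  fixes A :: "'a set" and c xopt :: 'a and zstar :: real
  assumes A_affine: "affine A" and e_in_A: "e \<in> A"
    and xopt_mem: "xopt \<in> A" "xopt \<in> K" and xopt_value: "c \<bullet> xopt = zstar"
    and zstar_le: "\<And>y. y \<in> A \<Longrightarrow> y \<in> K \<Longrightarrow> zstar \<le> c \<bullet> y"
begin

text \<open>
  The fraction of the possible descent from \<open>e\<close>, so that \<open>1 - rel_descent y\<close> is the relative error of
  \<open>y\<close>. It is constant on slices.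
\<close>
definition rel_descent :: "'a \<Rightarrow> real" where
  "rel_descent x = (c \<bullet> e - c \<bullet> x) / (c \<bullet> e - zstar)"

lemma ray_mem_A: "x \<in> A \<Longrightarrow> e + t *\<^sub>R (x - e) \<in> A"
  using mem_affine[OF A_affine e_in_A, of x "1 - t" t] by (simp add: algebra_simps)

text \<open>Otherwise \<open>x - e\<close> is a recession direction of the feasible set along which the objective is unbounded below.\<close>
lemma lambda_min_less_1:
  assumes "x \<in> A" "c \<bullet> x < c \<bullet> e"
  shows "lambda_min K e x < 1"
proof (rule ccontr)
  assume "\<not> lambda_min K e x < 1"
  then have rec: "x - e \<in> K" using lambda_min_ge_iff[of 1 x] by simp
  \<comment> \<open>The point at parameter \<open>t\<close> lies \<open>\<bar>c \<bullet> e - zstar\<bar> + 1\<close> below \<open>e\<close> in value, hence below \<open>zstar\<close>.\<close>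
  define t where "t = (\<bar>c \<bullet> e - zstar\<bar> + 1) / (c \<bullet> e - c \<bullet> x)"
  have "0 \<le> t" using assms(2) by (simp add: t_def)
  then have "zstar \<le> c \<bullet> (e + t *\<^sub>R (x - e))"
    using ray_mem_A[OF assms(1)] K_add[OF e_in_K K_scaleR[OF rec]] by (intro zstar_le) auto
  also have "\<dots> = c \<bullet> e - t * (c \<bullet> e - c \<bullet> x)"
    by (simp add: inner_simps algebra_simps)
  also have "\<dots> = c \<bullet> e - (\<bar>c \<bullet> e - zstar\<bar> + 1)" using assms(2) by (simp add: t_def)
  finally show False by linarith
qed

lemma radial_proj_mem_A: "x \<in> A \<Longrightarrow> radial_proj K e x \<in> A"
  by (simp add: radial_proj_def ray_mem_A)

lemma value_radial_proj:
  "c \<bullet> e - c \<bullet> radial_proj K e x = (c \<bullet> e - c \<bullet> x) / (1 - lambda_min K e x)"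
  by (simp add: radial_proj_def inner_simps diff_divide_distrib)

lemma radial_proj_value_less:
  assumes "x \<in> A" "c \<bullet> x < c \<bullet> e"
  shows "c \<bullet> radial_proj K e x < c \<bullet> e"
  using value_radial_proj[of x] lambda_min_less_1[OF assms] assms(2)
  by (smt (verit) divide_pos_pos)

lemma radial_proj_mem_K:
  assumes "x \<in> A" "c \<bullet> x < c \<bullet> e"
  shows "radial_proj K e x \<in> K"
  using lambda_min_radial_proj[OF lambda_min_less_1[OF assms]] by (simp add: mem_K_iff)

lemma zstar_less:
  assumes "x \<in> A" "c \<bullet> x < c \<bullet> e"
  shows "zstar < c \<bullet> e"
  using zstar_le[OF radial_proj_mem_A radial_proj_mem_K] radial_proj_value_less assms
  by fastforce

lemma rel_descent_pos:
  assumes "x \<in> A" "c \<bullet> x < c \<bullet> e"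
  shows "0 < rel_descent x"
  using zstar_less[OF assms] assms(2) by (simp add: rel_descent_def)

lemma rel_descent_radial_proj:
  "rel_descent (radial_proj K e x) = rel_descent x / (1 - lambda_min K e x)"
  by (simp add: rel_descent_def value_radial_proj)

lemma rel_error_eq:
  assumes "zstar < c \<bullet> e"
  shows "(c \<bullet> y - zstar) / (c \<bullet> e - zstar) = 1 - rel_descent y"
  using assms by (simp add: rel_descent_def field_simps)

text \<open>The radial projection of \<open>x\<close> is feasible, hence does not beat the optimal value.\<close>
lemma lambda_min_le:
  assumes "x \<in> A" "c \<bullet> x < c \<bullet> e"
  shows "lambda_min K e x \<le> 1 - rel_descent x"
proof -
  have "rel_descent (radial_proj K e x) \<le> 1"
    using zstar_le[OF radial_proj_mem_A radial_proj_mem_K] zstar_less assms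
    by (simp add: rel_descent_def)
  then show ?thesis
    using lambda_min_less_1[OF assms] by (simp add: rel_descent_radial_proj)
qed

text \<open>
  The point of the slice on the ray from \<open>e\<close> through the optimal solution attains the upper bound of
  \<open>lambda_min_le\<close>, which exhibits a maximizer and the maximum.
\<close>
lemma slice_maximizers:
  assumes "x \<in> A" "c \<bullet> x < c \<bullet> e"
  shows slice_maximizers_nonempty: "slice_maximizers K A c e (c \<bullet> x) \<noteq> {}"
    and lambda_min_maximizer:
      "y \<in> slice_maximizers K A c e (c \<bullet> x) \<Longrightarrow> lambda_min K e y = 1 - rel_descent x"
proof -
  define u where "u = e + rel_descent x *\<^sub>R (xopt - e)"
  have le: "lambda_min K e y \<le> 1 - rel_descent x" if "y \<in> affine_slice A c (c \<bullet> x)" for y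
    using lambda_min_le[of y] that assms by (simp add: affine_slice_def rel_descent_def)
  have "c \<bullet> u = c \<bullet> e - rel_descent x * (c \<bullet> e - zstar)"
    by (simp add: u_def inner_simps xopt_value algebra_simps)
  also have "\<dots> = c \<bullet> x" using zstar_less[OF assms] by (simp add: rel_descent_def)
  finally have u: "u \<in> affine_slice A c (c \<bullet> x)"
    using ray_mem_A[OF xopt_mem(1)] by (simp add: affine_slice_def u_def)
  have "0 \<le> rel_descent x * lambda_min K e xopt"
    using xopt_mem(2) rel_descent_pos[OF assms] by (simp add: mem_K_iff)
  then have ge: "1 - rel_descent x \<le> lambda_min K e u"
    using lambda_min_segment[OF rel_descent_pos[OF assms], of xopt]
    by (simp add: u_def algebra_simps)
  show "slice_maximizers K A c e (c \<bullet> x) \<noteq> {}"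
    using u ge le unfolding slice_maximizers_def by fastforce
  show "y \<in> slice_maximizers K A c e (c \<bullet> x) \<Longrightarrow> lambda_min K e y = 1 - rel_descent x"
    using u ge le unfolding slice_maximizers_def by fastforce
qed

text \<open>Within a slice the projected supgradient is as good as the supgradient itself.\<close>
lemma projected_supgradient:
  assumes "is_supgradient K e ip x s" "is_ip_projection ip (slice_space A c) s g"
    and "v \<in> slice_space A c"
  shows "lambda_min K e (x + v) \<le> lambda_min K e x + ip g v"
proof -
  have "ip s v = ip g v" using assms(2,3) by (simp add: is_ip_projection_def ip_simps)
  then show ?thesis using assms(1) unfolding is_supgradient_def by metis
qed

lemma subspace_slice: "subspace (slice_space A c)"
  using subspace_slice_space[OF A_affine] e_in_A by blast

lemma diff_mem_slice_space:
  "x \<in> affine_slice A c z \<Longrightarrow> y \<in> affine_slice A c z \<Longrightarrow> x - y \<in> slice_space A c"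
  by (auto simp: affine_slice_def slice_space_def affine_direction_def inner_diff_right)

lemma add_mem_slice:
  "x \<in> affine_slice A c z \<Longrightarrow> v \<in> slice_space A c \<Longrightarrow> x + v \<in> affine_slice A c z"
  using affine_slice_translate[OF A_affine] by blast

text \<open>
  The content is that the supremum defining the constant is finite: \<open>lambda_min\<close> is Lipschitz for the
  Euclidean norm, which the computational norm dominates up to a factor.
\<close>
lemma lipschitz_const_bound:
  assumes "x \<in> affine_slice A c z" "y \<in> affine_slice A c z"
  shows "\<bar>lambda_min K e x - lambda_min K e y\<bar> \<le> lipschitz_const K A c e ip z * ip_norm ip (x - y)"
proof (cases "x = y")
  case True
  then show ?thesis by (simp add: ip_norm_def ip_simps)
next
  case False
  let ?S = "{\<bar>lambda_min K e x - lambda_min K e y\<bar> / ip_norm ip (x - y) | x y.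
                  x \<in> affine_slice A c z \<and> y \<in> affine_slice A c z \<and> x \<noteq> y}"
  obtain C1 where C1: "0 < C1"
    "\<And>x y. \<bar>lambda_min K e x - lambda_min K e y\<bar> \<le> C1 * norm (x - y)"
    using lambda_min_lipschitz by metis
  obtain C2 where C2: "\<And>v. norm v \<le> C2 * ip_norm ip v"
    using norm_le_ip_norm by blast
  have "\<bar>lambda_min K e x - lambda_min K e y\<bar> / ip_norm ip (x - y) \<le> C1 * C2" if "x \<noteq> y" for x y
  proof -
    have "\<bar>lambda_min K e x - lambda_min K e y\<bar> \<le> C1 * (C2 * ip_norm ip (x - y))"
      using C1(2)[of x y] mult_left_mono[OF C2[of "x - y"], of C1] C1(1) by linarith
    then show ?thesis
      using ip_norm_pos[of "x - y"] that by (simp add: pos_divide_le_eq mult.assoc)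
  qed
  then have bdd: "bdd_above ?S" unfolding bdd_above_def by fast
  have "slice_space A c \<noteq> {0}" using diff_mem_slice_space[OF assms] False
    by (metis right_minus_eq singletonD)
  moreover have "\<bar>lambda_min K e x - lambda_min K e y\<bar> / ip_norm ip (x - y) \<le> Sup ?S"
    using assms False by (intro cSup_upper[OF _ bdd]) blast
  ultimately have "\<bar>lambda_min K e x - lambda_min K e y\<bar> / ip_norm ip (x - y)
      \<le> lipschitz_const K A c e ip z"
    unfolding lipschitz_const_def by (simp only: if_False)
  then show ?thesis
    using ip_norm_pos[of "x - y"] False by (simp add: pos_divide_le_eq)
qed

text \<open>
  The slice of \<open>z\<close> may differ from the slice of \<open>x\<close>: the constant of one slice serves for all of them.
  Moving from \<open>x\<close> by \<open>- t g\<close> loses at least \<open>t\<close> times the squared norm of \<open>g\<close>; moving likewise from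
  a point \<open>b\<close> of the other slice loses at most \<open>t\<close> times \<open>M\<close> times the norm of \<open>g\<close>. By superadditivity the
  values of \<open>lambda_min\<close> along the first ray exceed those along the second up to a constant, so
  letting \<open>t\<close> grow compares the two rates.
\<close>
lemma norm_projected_supgradient_le:
  assumes supg: "is_supgradient K e ip x s" "is_ip_projection ip (slice_space A c) s g"
    and b: "b \<in> affine_slice A c z" and g0: "g \<noteq> 0"
  shows "ip_norm ip g \<le> lipschitz_const K A c e ip z"
proof (rule ccontr)
  let ?M = "lipschitz_const K A c e ip z" and ?N = "ip_norm ip g"
  assume "\<not> ?N \<le> ?M"
  then have pos: "0 < ?N * (?N - ?M)" using ip_norm_pos[OF g0] by simp
  have gL: "g \<in> slice_space A c" using supg(2) by (simp add: is_ip_projection_def)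
  define C where "C = lambda_min K e x - lambda_min K e (x - b) - lambda_min K e b"
  have bound: "t * (?N * (?N - ?M)) \<le> C" if "0 < t" for t
  proof -
    have tL: "- (t *\<^sub>R g) \<in> slice_space A c"
      using gL subspace_slice by (simp add: subspace_scale subspace_neg)
    have "lambda_min K e (b + - (t *\<^sub>R g)) + lambda_min K e (x - b)
        \<le> lambda_min K e (x + - (t *\<^sub>R g))"
      using lambda_min_superadditive[of "b + - (t *\<^sub>R g)" "x - b"] by simp
    also have "\<dots> \<le> lambda_min K e x - t * ?N\<^sup>2"
      using projected_supgradient[OF supg tL] by (simp add: ip_simps ip_norm_sq)
    finally have "lambda_min K e (b + - (t *\<^sub>R g)) + lambda_min K e (x - b)
        \<le> lambda_min K e x - t * ?N\<^sup>2" .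
    moreover have "\<bar>lambda_min K e b - lambda_min K e (b + - (t *\<^sub>R g))\<bar> \<le> ?M * (t * ?N)"
      using lipschitz_const_bound[OF b add_mem_slice[OF b tL]] that
      by (simp add: ip_norm_scaleR)
    ultimately have "t * ?N\<^sup>2 - ?M * (t * ?N) \<le> C" unfolding C_def by linarith
    then show ?thesis by (simp add: algebra_simps power2_eq_square)
  qed
  have "(\<bar>C\<bar> + 1) / (?N * (?N - ?M)) * (?N * (?N - ?M)) \<le> C"
    using pos by (intro bound divide_pos_pos) auto
  then have "\<bar>C\<bar> + 1 \<le> C" using pos by (metis nonzero_eq_divide_eq less_irrefl)
  then show False by linarith
qed

lemma dist_opt_nonneg:
  assumes "x \<in> A" "c \<bullet> x < c \<bullet> e"
  shows "0 \<le> dist_opt K A c e ip (c \<bullet> x) y"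
  unfolding dist_opt_def using slice_maximizers_nonempty[OF assms]
  by (intro cINF_greatest ip_norm_nonneg)

text \<open>
  The classical estimate for supgradient ascent. For every maximizer \<open>y\<close>, expanding the square of
  \<open>x + a g - y\<close> gives the change \<open>- 2 a (g, y - x) + a\<^sup>2 (g, g)\<close>; the supgradient inequality bounds \<open>(g, y - x)\<close>
  below by the gap \<open>1 - rel_descent x - lambda_min K e x\<close>, and with this step length the quadratic term costs \<open>\<epsilon> / 4\<close>
  of the gap. The estimate passes to the infimum over \<open>y\<close>.
\<close>
lemma dist_opt_step:
  assumes x: "x \<in> A" "c \<bullet> x < c \<bullet> e"
    and supg: "is_supgradient K e ip x s" "is_ip_projection ip (slice_space A c) s g"
    and g0: "g \<noteq> 0" and gM: "ip_norm ip g \<le> M"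
    and eps: "0 < \<epsilon>" and w: "0 < w" "w + \<epsilon> / 4 \<le> 1 - rel_descent x - lambda_min K e x"
  shows "(dist_opt K A c e ip (c \<bullet> x) (x + (\<epsilon> / (2 * (ip_norm ip g)\<^sup>2)) *\<^sub>R g))\<^sup>2 + \<epsilon> / M\<^sup>2 * w
    \<le> (dist_opt K A c e ip (c \<bullet> x) x)\<^sup>2"
proof -
  define a where "a = \<epsilon> / (2 * (ip_norm ip g)\<^sup>2)"
  let ?D = "dist_opt K A c e ip (c \<bullet> x)"
  let ?Y = "slice_maximizers K A c e (c \<bullet> x)"
  let ?q = "(?D (x + a *\<^sub>R g))\<^sup>2 + \<epsilon> / M\<^sup>2 * w"
  have N: "0 < (ip_norm ip g)\<^sup>2" using ip_norm_pos[OF g0] by simp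
  have a: "a * (ip_norm ip g)\<^sup>2 = \<epsilon> / 2" "0 < a" using N eps by (auto simp: a_def)
  have q0: "0 \<le> ?q" using eps w(1) by simp
  have "sqrt ?q \<le> ip_norm ip (x - y)" if y: "y \<in> ?Y" for y
  proof -
    have "y \<in> affine_slice A c (c \<bullet> x)" using y by (simp add: slice_maximizers_def)
    then have "y - x \<in> slice_space A c"
      using x by (intro diff_mem_slice_space) (auto simp: affine_slice_def)
    then have "1 - rel_descent x \<le> lambda_min K e x + ip g (y - x)"
      using projected_supgradient[OF supg, of "y - x"] lambda_min_maximizer[OF x y] by simp
    then have gap: "w + \<epsilon> / 4 \<le> ip g (y - x)" using w(2) by linarith
    have bdd: "bdd_below ((\<lambda>y. ip_norm ip (x + a *\<^sub>R g - y)) ` ?Y)"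
      by (intro bdd_belowI[of _ 0]) (auto simp: ip_norm_nonneg)
    have "?D (x + a *\<^sub>R g) \<le> ip_norm ip (x + a *\<^sub>R g - y)"
      unfolding dist_opt_def by (rule cINF_lower[OF bdd y])
    then have "(?D (x + a *\<^sub>R g))\<^sup>2 \<le> (ip_norm ip (x + a *\<^sub>R g - y))\<^sup>2"
      using dist_opt_nonneg[OF x] by (intro power_mono)
    also have "\<dots> = (ip_norm ip (x - y))\<^sup>2 - 2 * a * ip g (y - x) + a * (a * (ip_norm ip g)\<^sup>2)"
      by (simp add: ip_norm_sq ip_simps ip_sym[of g x] ip_sym[of g y] ip_sym[of y x] algebra_simps)
    also have "\<dots> \<le> (ip_norm ip (x - y))\<^sup>2 - 2 * a * (w + \<epsilon> / 4) + a * (\<epsilon> / 2)"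
      unfolding a(1) using mult_left_mono[OF gap, of "2 * a"] a(2) by linarith
    also have "\<dots> = (ip_norm ip (x - y))\<^sup>2 - \<epsilon> / (ip_norm ip g)\<^sup>2 * w"
    proof -
      have "2 * a * (w + \<epsilon> / 4) = 2 * a * w + a * (\<epsilon> / 2)" by (simp add: distrib_left)
      moreover have "2 * a = \<epsilon> / (ip_norm ip g)\<^sup>2" by (simp add: a_def)
      ultimately show ?thesis by simp
    qed
    also have "\<dots> \<le> (ip_norm ip (x - y))\<^sup>2 - \<epsilon> / M\<^sup>2 * w"
    proof -
      have "(ip_norm ip g)\<^sup>2 \<le> M\<^sup>2" using gM ip_norm_nonneg by (intro power_mono)
      then have "\<epsilon> / M\<^sup>2 \<le> \<epsilon> / (ip_norm ip g)\<^sup>2"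
        using N eps by (intro divide_left_mono mult_pos_pos) linarith+
      then have "\<epsilon> / M\<^sup>2 * w \<le> \<epsilon> / (ip_norm ip g)\<^sup>2 * w"
        using w(1) by (intro mult_right_mono) linarith+
      then show ?thesis by linarith
    qed
    finally have "?q \<le> (ip_norm ip (x - y))\<^sup>2" by linarith
    then show ?thesis by (rule real_le_lsqrt[OF ip_norm_nonneg])
  qed
  then have "sqrt ?q \<le> ?D x"
    unfolding dist_opt_def[of _ _ _ _ _ _ x]
    by (rule cINF_greatest[OF slice_maximizers_nonempty[OF x]])
  from power_mono[OF this real_sqrt_ge_zero[OF q0], of 2] show ?thesis
    unfolding a_def[symmetric] real_sqrt_pow2[OF q0] .
qed

end

section \<open>Counting the steps of a restarted ascent\<close>

text \<open>
  The guaranteed gap in a slice with relative descent \<open>s\<close>, reduced by the cost \<open>\<epsilon> / 4\<close> of the quadratic term.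
\<close>
definition step_gain :: "real \<Rightarrow> real \<Rightarrow> real" where
  "step_gain \<epsilon> s = max (3 / 4 - s - \<epsilon> / 4) (\<epsilon> / 2)"

text \<open>
  The thresholds are the last two possible values of \<open>s\<close> before \<open>1 - \<epsilon>\<close> when each restart multiplies \<open>s\<close> by
  exactly \<open>4/3\<close>. A restart that lands above the first of them raises this number, so it bounds the
  number of stretches in which only the gain \<open>\<epsilon> / 2\<close> is available.
\<close>
definition late_restarts :: "real \<Rightarrow> real \<Rightarrow> real" where
  "late_restarts \<epsilon> s =
     (if s \<le> 9 / 16 * (1 - \<epsilon>) then 0 else if s \<le> 3 / 4 * (1 - \<epsilon>) then 1 else 2)"

lemma step_gain_pos: "0 < \<epsilon> \<Longrightarrow> 0 < step_gain \<epsilon> s"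
  by (simp add: step_gain_def less_max_iff_disj)

lemma inverse_step_gain_le:
  assumes "0 < \<epsilon>"
  shows "1 / step_gain \<epsilon> s \<le> 2 / \<epsilon>"
    and "s \<le> 9 / 16 * (1 - \<epsilon>) \<Longrightarrow> 1 / step_gain \<epsilon> s \<le> 8"
proof -
  have "1 / step_gain \<epsilon> s \<le> 1 / (\<epsilon> / 2)"
    using assms by (intro divide_left_mono) (auto simp: step_gain_def less_max_iff_disj)
  then show "1 / step_gain \<epsilon> s \<le> 2 / \<epsilon>" by simp
  assume "s \<le> 9 / 16 * (1 - \<epsilon>)"
  then have "1 / 8 \<le> step_gain \<epsilon> s"
    using assms by (simp add: step_gain_def le_max_iff_disj)
  then have "1 / step_gain \<epsilon> s \<le> 1 / (1 / 8)"
    using step_gain_pos[OF assms] by (intro divide_left_mono) auto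
  then show "1 / step_gain \<epsilon> s \<le> 8" by simp
qed

text \<open>
  Here \<open>s k\<close> stands for the relative descent and \<open>d k\<close> for the squared distance to the maximizers. The
  potential \<open>k \<eta> + d k / step_gain \<epsilon> (s k)\<close> does not increase within a stretch. A restart
  increases it by at most \<open>Q / step_gain\<close>, where \<open>afford\<close> pays for the step that leads to the restart.
  This increase is paid by the growth of \<open>Q G(s)\<close>: an early stretch costs at most \<open>8 Q\<close>, the growth
  of the logarithmic term, and a late one at most \<open>2 Q / \<epsilon>\<close>, the growth of \<open>late_restarts\<close>; the
  summand \<open>8\<close> of \<open>G\<close> covers an early first stretch. In the end
  \<open>afford\<close> counts one more step, which yields \<open>l + 1\<close> and hence a strict inequality for \<open>l\<close>.
\<close>
lemma restart_count:
  fixes s d :: "nat \<Rightarrow> real"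
  assumes eps: "0 < \<epsilon>" and eta: "0 < \<eta>"
    and start: "0 < s 0" "d 0 \<le> Q"
    and bound: "\<And>k. k \<le> l \<Longrightarrow> s k \<le> 1 - \<epsilon>"
    and afford: "\<And>k. k \<le> l \<Longrightarrow> \<eta> * step_gain \<epsilon> (s k) \<le> d k"
    and step: "\<And>k. k < l \<Longrightarrow>
      (s (Suc k) = s k \<and> d (Suc k) + \<eta> * step_gain \<epsilon> (s k) \<le> d k) \<or>
      (4 / 3 * s k \<le> s (Suc k) \<and> d (Suc k) \<le> Q)"
  shows "(real l + 1) * \<eta> \<le> Q * (8 * log (4 / 3) ((1 - \<epsilon>) / s 0) + 8 + 4 / \<epsilon>)"
proof -
  define G where "G t = 8 * log (4 / 3) (t / s 0) + 8 + late_restarts \<epsilon> t * (2 / \<epsilon>)" for t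
  have Q0: "0 \<le> Q"
    using afford[of 0] start(2) mult_pos_pos[OF eta step_gain_pos[OF eps, of "s 0"]] by linarith
  have inv: "s 0 \<le> s k \<and> real k * \<eta> + d k / step_gain \<epsilon> (s k) \<le> Q * G (s k)" if "k \<le> l" for k
    using that
  proof (induction k)
    case 0
    have "1 / step_gain \<epsilon> (s 0) \<le> 8 + late_restarts \<epsilon> (s 0) * (2 / \<epsilon>)"
    proof (cases "s 0 \<le> 9 / 16 * (1 - \<epsilon>)")
      case True
      then show ?thesis
        using inverse_step_gain_le(2)[OF eps True] by (simp add: late_restarts_def)
    next
      case False
      then have "1 * (2 / \<epsilon>) \<le> late_restarts \<epsilon> (s 0) * (2 / \<epsilon>)"
        using eps by (intro mult_right_mono) (auto simp: late_restarts_def)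
      then show ?thesis using inverse_step_gain_le(1)[OF eps, of "s 0"] by linarith
    qed
    also have "\<dots> = G (s 0)" using start(1) by (simp add: G_def)
    finally have "Q * (1 / step_gain \<epsilon> (s 0)) \<le> Q * G (s 0)" by (intro mult_left_mono Q0)
    moreover have "d 0 / step_gain \<epsilon> (s 0) \<le> Q * (1 / step_gain \<epsilon> (s 0))"
      using start(2) step_gain_pos[OF eps, of "s 0"] by (simp add: divide_right_mono)
    ultimately show ?case
by simp
  next
    case (Suc k)
    then have k: "k < l" "k \<le> l" and IH0: "s 0 \<le> s k"
      and IH: "real k * \<eta> + d k / step_gain \<epsilon> (s k) \<le> Q * G (s k)" by auto
    have w: "0 < step_gain \<epsilon> (s k)" using step_gain_pos[OF eps] .
    from step[OF k(1)] show ?case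
    proof (elim disjE conjE)
      assume same: "s (Suc k) = s k" and d: "d (Suc k) + \<eta> * step_gain \<epsilon> (s k) \<le> d k"
      have "(d (Suc k) + \<eta> * step_gain \<epsilon> (s k)) / step_gain \<epsilon> (s k) \<le> d k / step_gain \<epsilon> (s k)"
        using d w by (simp add: divide_right_mono)
      then have "d (Suc k) / step_gain \<epsilon> (s k) + \<eta> \<le> d k / step_gain \<epsilon> (s k)"
        using w by (simp add: add_divide_distrib)
      then show ?thesis using IH IH0 same by (simp add: algebra_simps)
    next
      assume jump: "4 / 3 * s k \<le> s (Suc k)" and d: "d (Suc k) \<le> Q"
      have sk: "0 < s k" using IH0 start(1) by linarith
      have w': "0 < step_gain \<epsilon> (s (Suc k))" using step_gain_pos[OF eps] .
      have "\<eta> \<le> d k / step_gain \<epsilon> (s k)"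
        using afford[OF k(2)] w by (simp add: pos_le_divide_eq)
      then have 1: "real (Suc k) * \<eta> \<le> Q * G (s k)" using IH by (simp add: algebra_simps)
      have "log (4 / 3) (4 / 3 * (s k / s 0)) \<le> log (4 / 3) (s (Suc k) / s 0)"
        using jump sk start(1) by (simp add: log_le_cancel_iff divide_right_mono field_simps)
      moreover have "log (4 / 3) (4 / 3 * (s k / s 0)) = 1 + log (4 / 3) (s k / s 0)"
        using sk start(1) by (subst log_mult) auto
      ultimately have lg: "1 + log (4 / 3) (s k / s 0) \<le> log (4 / 3) (s (Suc k) / s 0)" by linarith
      have sS: "s (Suc k) \<le> 1 - \<epsilon>" using bound Suc.prems by blast
      have mono: "late_restarts \<epsilon> (s k) \<le> late_restarts \<epsilon> (s (Suc k))"
        using jump sk by (auto simp: late_restarts_def)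
      have "1 / step_gain \<epsilon> (s (Suc k)) + G (s k) \<le> G (s (Suc k))"
      proof (cases "s (Suc k) \<le> 9 / 16 * (1 - \<epsilon>)")
        case True
        have "late_restarts \<epsilon> (s k) * (2 / \<epsilon>) \<le> late_restarts \<epsilon> (s (Suc k)) * (2 / \<epsilon>)"
          using mono eps by (intro mult_right_mono) auto
        then show ?thesis
          using lg inverse_step_gain_le(2)[OF eps True] by (simp add: G_def)
      next
        case False
        have "late_restarts \<epsilon> (s k) + 1 \<le> late_restarts \<epsilon> (s (Suc k))"
          using jump sk False sS by (auto simp: late_restarts_def)
        then have "(late_restarts \<epsilon> (s k) + 1) * (2 / \<epsilon>) \<le> late_restarts \<epsilon> (s (Suc k)) * (2 / \<epsilon>)"
          using eps by (intro mult_right_mono) auto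
        then show ?thesis
          using lg inverse_step_gain_le(1)[OF eps, of "s (Suc k)"]
          unfolding G_def distrib_right by linarith
      qed
      then have "Q * (1 / step_gain \<epsilon> (s (Suc k))) + Q * G (s k) \<le> Q * G (s (Suc k))"
        using mult_left_mono[OF _ Q0] by (simp only: distrib_left[symmetric])
      moreover have "d (Suc k) / step_gain \<epsilon> (s (Suc k)) \<le> Q * (1 / step_gain \<epsilon> (s (Suc k)))"
        using d w' by (simp add: divide_right_mono)
      ultimately show ?thesis using 1 jump sk IH0 by linarith
    qed
  qed
  have sl: "s 0 \<le> s l" and l: "real l * \<eta> + d l / step_gain \<epsilon> (s l) \<le> Q * G (s l)"
    using inv[of l] by auto
  have "\<eta> \<le> d l / step_gain \<epsilon> (s l)"
    using afford[of l] step_gain_pos[OF eps] by (simp add: pos_le_divide_eq)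
  then have "(real l + 1) * \<eta> \<le> Q * G (s l)" using l by (simp add: algebra_simps)
  also have "G (s l) \<le> 8 * log (4 / 3) ((1 - \<epsilon>) / s 0) + 8 + 4 / \<epsilon>"
  proof -
    have "log (4 / 3) (s l / s 0) \<le> log (4 / 3) ((1 - \<epsilon>) / s 0)"
      using sl start(1) bound[of l] by (simp add: divide_right_mono)
    moreover have "late_restarts \<epsilon> (s l) * (2 / \<epsilon>) \<le> 2 * (2 / \<epsilon>)"
      using eps by (intro mult_right_mono) (auto simp: late_restarts_def)
    ultimately show ?thesis by (simp add: G_def)
  qed
  finally show ?thesis using Q0 by (simp add: mult_left_mono)
qed

section \<open>Runs of the algorithm\<close>

context conic_program
begin

lemma rel_error_radial_proj:
  assumes "x \<in> A" "c \<bullet> x < c \<bullet> e"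
  shows "\<epsilon> < (c \<bullet> radial_proj K e x - zstar) / (c \<bullet> e - zstar) \<longleftrightarrow>
    \<epsilon> * (1 - lambda_min K e x) < 1 - rel_descent x - lambda_min K e x"
  using lambda_min_less_1[OF assms]
  by (simp add: rel_error_eq[OF zstar_less[OF assms]] rel_descent_radial_proj field_simps)

text \<open>If the projected supgradient vanishes, the point maximizes \<open>lambda_min\<close> over its slice.\<close>
lemma projected_supgradient_nonzero:
  assumes x: "x \<in> A" "c \<bullet> x < c \<bullet> e"
    and supg: "is_supgradient K e ip x s" "is_ip_projection ip (slice_space A c) s g"
    and "lambda_min K e x < 1 - rel_descent x"
  shows "g \<noteq> 0"
proof
  assume "g = 0"
  obtain y where y: "y \<in> slice_maximizers K A c e (c \<bullet> x)"
    using slice_maximizers_nonempty[OF x] by blast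
  then have "y - x \<in> slice_space A c"
    using x by (intro diff_mem_slice_space) (auto simp: affine_slice_def slice_maximizers_def)
  then have "lambda_min K e y \<le> lambda_min K e x"
    using projected_supgradient[OF supg, of "y - x"] \<open>g = 0\<close> by (simp add: ip_simps)
  then show False using lambda_min_maximizer[OF x y] assms(5) by linarith
qed

text \<open>
  The hypothesis \<open>lambda_min K e x \<le> 1 / 4\<close> bounds the gap below in two ways: directly by
  \<open>3/4 - rel_descent x\<close>, and through inaccuracy by \<open>3 \<epsilon> / 4\<close>.
\<close>
lemma step_gain_le:
  assumes "0 < \<epsilon>" "lambda_min K e x \<le> 1 / 4"
    and "\<epsilon> * (1 - lambda_min K e x) < 1 - rel_descent x - lambda_min K e x"
  shows "step_gain \<epsilon> (rel_descent x) + \<epsilon> / 4 \<le> 1 - rel_descent x - lambda_min K e x"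
proof -
  have "\<epsilon> * (3 / 4) \<le> \<epsilon> * (1 - lambda_min K e x)"
    using assms(1,2) by (intro mult_left_mono) auto
  then have "\<epsilon> * (3 / 4) < 1 - rel_descent x - lambda_min K e x" using assms(3) by linarith
  then show ?thesis using assms(2) unfolding step_gain_def max_def by (simp split: if_split)
qed

lemma dist_opt_le_Dist_opt:
  "x \<in> A \<Longrightarrow> x \<in> K \<Longrightarrow> c \<bullet> x \<le> z \<Longrightarrow>
    ereal (dist_opt K A c e ip (c \<bullet> x) x) \<le> Dist_opt K A c e ip z"
  unfolding Dist_opt_def by (rule Sup_upper) (auto simp: level_def affine_slice_def)

lemma exists_slice_point:
  assumes "v \<in> affine_direction A" "c \<bullet> v \<noteq> 0"
  shows "\<exists>b. b \<in> affine_slice A c z"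
proof -
  obtain u w where uw: "u \<in> A" "w \<in> A" "v = u - w"
    using assms(1) by (auto simp: affine_direction_def)
  define t where "t = (z - c \<bullet> e) / (c \<bullet> v)"
  have "e + t *\<^sub>R (u - w) \<in> A"
    using mem_affine_3_minus[OF A_affine e_in_A uw(1,2)] .
  then show ?thesis
    using assms(2) uw(3) by (intro exI[of _ "e + t *\<^sub>R v"]) (simp add: affine_slice_def t_def inner_simps)
qed

text \<open>
  What holds for an iterate \<open>y\<close> with radial projection \<open>q\<close> as long as all projections so far are
  inaccurate; \<open>z0\<close> is the objective value of the first iterate, which keeps every slice in the range of
  \<open>Dist_opt\<close>. The bound \<open>1 / 4\<close> is the negation of the restart test, since the projection divides the
  descent by \<open>1 - lambda_min\<close> and \<open>1 / (1 - 1/4) = 4/3\<close>.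
\<close>
definition run_invariant :: "real \<Rightarrow> real \<Rightarrow> 'a \<Rightarrow> 'a \<Rightarrow> bool" where
  "run_invariant \<epsilon> z0 y q \<longleftrightarrow> y \<in> A \<and> c \<bullet> y \<le> z0 \<and> radial_proj K e y = q \<and>
     lambda_min K e y \<le> 1 / 4 \<and> rel_descent y \<le> 1 - \<epsilon>"

lemma run_start:
  assumes xbar: "xbar \<in> A" "c \<bullet> xbar < c \<bullet> e"
    and err: "\<epsilon> < (c \<bullet> radial_proj K e xbar - zstar) / (c \<bullet> e - zstar)"
  shows "run_invariant \<epsilon> (c \<bullet> radial_proj K e xbar) (radial_proj K e xbar) (radial_proj K e xbar)"
  using radial_proj_mem_A[OF xbar(1)] lambda_min_radial_proj[OF lambda_min_less_1[OF xbar]] err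
  by (simp add: run_invariant_def radial_proj_boundary rel_error_eq[OF zstar_less[OF xbar]])

text \<open>
  The alternatives of the last conclusion are exactly those of \<open>restart_count\<close>; membership of a restart
  point in \<open>K\<close> is what brings \<open>Dist_opt\<close> into play.
\<close>
lemma run_step:
  fixes y q :: 'a and \<epsilon> z0 :: real
  assumes inv: "run_invariant \<epsilon> z0 y q" and z0: "z0 < c \<bullet> e"
    and err: "\<epsilon> < (c \<bullet> q - zstar) / (c \<bullet> e - zstar)" and eps: "0 < \<epsilon>"
    and supg: "is_supgradient K e ip y s" "is_ip_projection ip (slice_space A c) s g"
    and b: "b \<in> affine_slice A c z"
    and M: "M = lipschitz_const K A c e ip z"
    and yt: "yt = (if g = 0 then y else y + (\<epsilon> / (2 * (ip_norm ip g)\<^sup>2)) *\<^sub>R g)"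
    and q': "q' = radial_proj K e yt"
    and y': "y' = (if c \<bullet> (e - q') \<ge> 4 / 3 * (c \<bullet> (e - yt)) then q' else yt)"
  shows "0 < M"
    and "\<epsilon> / M\<^sup>2 * step_gain \<epsilon> (rel_descent y) \<le> (dist_opt K A c e ip (c \<bullet> y) y)\<^sup>2"
    and "\<epsilon> < (c \<bullet> q' - zstar) / (c \<bullet> e - zstar) \<Longrightarrow> run_invariant \<epsilon> z0 y' q' \<and>
      ((rel_descent y' = rel_descent y \<and>
        (dist_opt K A c e ip (c \<bullet> y') y')\<^sup>2 + \<epsilon> / M\<^sup>2 * step_gain \<epsilon> (rel_descent y)
          \<le> (dist_opt K A c e ip (c \<bullet> y) y)\<^sup>2)
      \<or> (4 / 3 * rel_descent y \<le> rel_descent y' \<and> y' \<in> K))"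
proof -
  have y: "y \<in> A" "c \<bullet> y < c \<bullet> e" and yz: "c \<bullet> y \<le> z0" and qy: "radial_proj K e y = q"
    and lam: "lambda_min K e y \<le> 1 / 4" and gap: "rel_descent y \<le> 1 - \<epsilon>"
    using inv z0 by (auto simp: run_invariant_def)
  note zs = zstar_less[OF y]
  have err': "\<epsilon> * (1 - lambda_min K e y) < 1 - rel_descent y - lambda_min K e y"
    using err qy rel_error_radial_proj[OF y] by simp
  have "0 < \<epsilon> * (1 - lambda_min K e y)" using eps lam by (intro mult_pos_pos) auto
  then have g0: "g \<noteq> 0"
    using err' by (intro projected_supgradient_nonzero[OF y supg]) linarith
  have gM: "ip_norm ip g \<le> M"
    unfolding M by (rule norm_projected_supgradient_le[OF supg b g0])
  then show "0 < M" using ip_norm_pos[OF g0] by linarith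
  have yt': "yt = y + (\<epsilon> / (2 * (ip_norm ip g)\<^sup>2)) *\<^sub>R g" using yt g0 by simp
  have dec: "(dist_opt K A c e ip (c \<bullet> y) yt)\<^sup>2 + \<epsilon> / M\<^sup>2 * step_gain \<epsilon> (rel_descent y)
      \<le> (dist_opt K A c e ip (c \<bullet> y) y)\<^sup>2"
    unfolding yt'
    by (rule dist_opt_step[OF y supg g0 gM eps step_gain_pos[OF eps] step_gain_le[OF eps lam err']])
  then show "\<epsilon> / M\<^sup>2 * step_gain \<epsilon> (rel_descent y) \<le> (dist_opt K A c e ip (c \<bullet> y) y)\<^sup>2"
    using zero_le_power2[of "dist_opt K A c e ip (c \<bullet> y) yt"] by linarith
  have "yt \<in> affine_slice A c (c \<bullet> y)"
    unfolding yt' using y(1) supg(2) subspace_slice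
    by (intro add_mem_slice subspace_scale) (auto simp: affine_slice_def is_ip_projection_def)
  then have ytA: "yt \<in> A" and cyt: "c \<bullet> yt = c \<bullet> y" by (auto simp: affine_slice_def)
  then have ytc: "c \<bullet> yt < c \<bullet> e" using y(2) by simp
  have gyt: "rel_descent yt = rel_descent y" using cyt by (simp add: rel_descent_def)
  note lt1 = lambda_min_less_1[OF ytA ytc]
  have q'A: "q' \<in> A" "c \<bullet> q' < c \<bullet> e" "q' \<in> K"
    using radial_proj_mem_A[OF ytA] radial_proj_value_less[OF ytA ytc] radial_proj_mem_K[OF ytA ytc]
    by (auto simp: q')
  have q'0: "lambda_min K e q' = 0" using lambda_min_radial_proj[OF lt1] by (simp add: q')
  assume "\<epsilon> < (c \<bullet> q' - zstar) / (c \<bullet> e - zstar)"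
  then have gq': "rel_descent q' \<le> 1 - \<epsilon>" using rel_error_eq[OF zs] by simp
  show "run_invariant \<epsilon> z0 y' q' \<and>
      ((rel_descent y' = rel_descent y \<and>
        (dist_opt K A c e ip (c \<bullet> y') y')\<^sup>2 + \<epsilon> / M\<^sup>2 * step_gain \<epsilon> (rel_descent y)
          \<le> (dist_opt K A c e ip (c \<bullet> y) y)\<^sup>2)
      \<or> (4 / 3 * rel_descent y \<le> rel_descent y' \<and> y' \<in> K))"
  proof (cases "c \<bullet> (e - q') \<ge> 4 / 3 * (c \<bullet> (e - yt))")
    case True
    then have y'q: "y' = q'" using y' by simp
    have jump: "4 / 3 * (c \<bullet> e - c \<bullet> y) \<le> c \<bullet> e - c \<bullet> q'"
      using True cyt by (simp add: inner_diff_right)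
    then have "4 / 3 * (c \<bullet> e - c \<bullet> y) / (c \<bullet> e - zstar) \<le> (c \<bullet> e - c \<bullet> q') / (c \<bullet> e - zstar)"
      using zs by (intro divide_right_mono) auto
    then have "4 / 3 * rel_descent y \<le> rel_descent q'" by (simp add: rel_descent_def)
    moreover have "c \<bullet> q' \<le> z0" using jump y(2) yz by argo
    ultimately show ?thesis
      using q'A q'0 gq' y'q by (simp add: run_invariant_def radial_proj_boundary)
  next
    case False
    then have y'y: "y' = yt" using y' by simp
    have "(c \<bullet> e - c \<bullet> yt) / (1 - lambda_min K e yt) < 4 / 3 * (c \<bullet> e - c \<bullet> yt)"
      using False value_radial_proj[of yt] by (simp add: inner_diff_right q')
    then have "(c \<bullet> e - c \<bullet> yt) * 1 < (c \<bullet> e - c \<bullet> yt) * (4 / 3 * (1 - lambda_min K e yt))"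
      using lt1 by (subst (asm) pos_divide_less_eq) (auto simp: algebra_simps)
    then have "1 < 4 / 3 * (1 - lambda_min K e yt)"
      using ytc by (subst (asm) mult_less_cancel_left_pos) auto
    then have "lambda_min K e yt \<le> 1 / 4" by argo
    then show ?thesis
      using dec ytA cyt yz gyt gap y'y q' by (simp add: run_invariant_def)
  qed
qed

end

theorem theorem3p8:
  fixes K A :: "'a::euclidean_space set"
    and c e xbar :: 'a
    and ip :: "'a \<Rightarrow> 'a \<Rightarrow> real"
    and \<epsilon> z zstar M :: real
    and x xt p g :: "nat \<Rightarrow> 'a"
    and l :: nat
  assumes "closed K" and "convex_cone K" and "K \<noteq> UNIV" and "interior K \<noteq> {}"
    and "affine A"
    and "\<exists>v \<in> affine_direction A. c \<bullet> v \<noteq> 0"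
    and "\<exists>xopt. is_optimal_solution K A c xopt"
    and "e \<in> A \<inter> interior K"
    and "is_inner_product ip"
    and "zstar = optimal_value K A c"
    and "M = lipschitz_const K A c e ip z"
    and "0 < \<epsilon>" and "\<epsilon> < 1"
    and "xbar \<in> A" and "c \<bullet> xbar < c \<bullet> e"
    and "is_algorithm2_run K A c e ip \<epsilon> xbar x xt p g"
    and "\<epsilon> \<le> (c \<bullet> p 0 - zstar) / (c \<bullet> e - zstar)"
    and "ereal (real l) \<ge>
           8 * (ereal M * Dist_opt K A c e ip (c \<bullet> p 0))\<^sup>2 *
           ereal (1 / \<epsilon>\<^sup>2
             + 1 / \<epsilon> * log (4 / 3) ((1 - \<epsilon>) / (1 - (c \<bullet> p 0 - zstar) / (c \<bullet> e - zstar)))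
             + 1)"
  shows "(MIN k\<in>{..l}. (c \<bullet> p k - zstar) / (c \<bullet> e - zstar)) \<le> \<epsilon>"
proof (rule ccontr)
  assume "\<not> ?thesis"
  then have err: "\<epsilon> < (c \<bullet> p k - zstar) / (c \<bullet> e - zstar)" if "k \<le> l" for k
    using that by (subst (asm) not_le, subst (asm) Min_gr_iff) auto
  obtain xopt where opt: "xopt \<in> A \<inter> K" "\<And>y. y \<in> A \<inter> K \<Longrightarrow> c \<bullet> xopt \<le> c \<bullet> y"
    using assms(7) by (auto simp: is_optimal_solution_def)
  have "zstar = c \<bullet> xopt"
    unfolding assms(10) optimal_value_def using opt by (intro cInf_eq_minimum) auto
  then interpret conic_program K e ip A c xopt zstar
    using assms(1-3,5,8,9) opt by unfold_locales auto
  have run: "p 0 = radial_proj K e xbar" "x 0 = p 0"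
    "\<And>k. \<exists>s. is_supgradient K e ip (x k) s \<and> is_ip_projection ip (slice_space A c) s (g k)"
    "\<And>k. xt (Suc k) =
          (if g k = 0 then x k else x k + (\<epsilon> / (2 * (ip_norm ip (g k))\<^sup>2)) *\<^sub>R g k)"
    "\<And>k. p (Suc k) = radial_proj K e (xt (Suc k))"
    "\<And>k. x (Suc k) =
          (if c \<bullet> (e - p (Suc k)) \<ge> 4 / 3 * (c \<bullet> (e - xt (Suc k))) then p (Suc k)
           else xt (Suc k))"
    using assms(16) unfolding is_algorithm2_run_def by blast+
  obtain b where b: "b \<in> affine_slice A c z" using assms(6) exists_slice_point by blast
  have z0: "c \<bullet> p 0 < c \<bullet> e" and p0: "p 0 \<in> A" "p 0 \<in> K"
    using radial_proj_value_less radial_proj_mem_A radial_proj_mem_K assms(14,15)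
    by (auto simp: run(1))
  note zs = zstar_less[OF p0(1) z0]
  let ?D = "\<lambda>k. dist_opt K A c e ip (c \<bullet> x k) (x k)"
  note step = run_step[OF _ z0 err assms(12) _ _ b assms(11) run(4,5,6)]
  have inv: "run_invariant \<epsilon> (c \<bullet> p 0) (x k) (p k)" if "k \<le> l" for k
    using that
  proof (induction k)
    case 0
    show ?case using run_start[OF assms(14,15)] err[of 0] by (simp add: run(1,2))
  next
    case (Suc k)
    obtain s where "is_supgradient K e ip (x k) s" "is_ip_projection ip (slice_space A c) s (g k)"
      using run(3) by blast
    then show ?case using step(3)[OF Suc.IH, of s] Suc.prems err[OF Suc.prems] by simp
  qed
  \<comment> \<open>Since \<open>0 * \<infinity> = 0\<close>, only a positive \<open>M\<close> lets the bound on \<open>l\<close> exclude an infinite \<open>Dist_opt\<close>.\<close>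
  have M: "0 < M" using step(1)[OF inv, of 0] run(3)[of 0] by blast
  define L where "L = log (4 / 3) ((1 - \<epsilon>) / rel_descent (p 0))"
  have gap0: "0 < rel_descent (p 0)" "rel_descent (p 0) \<le> 1 - \<epsilon>"
    using rel_descent_pos[OF p0(1) z0] assms(17) rel_error_eq[OF zs, of "p 0"] by auto
  then have L: "0 \<le> L" by (simp add: L_def)
  define T where "T = 1 / \<epsilon>\<^sup>2 + 1 / \<epsilon> * L + 1"
  have T: "0 < T" using assms(12) L by (simp add: T_def add_nonneg_pos)
  have large: "8 * (ereal M * Dist_opt K A c e ip (c \<bullet> p 0))\<^sup>2 * ereal T \<le> ereal (real l)"
    using assms(18) by (simp add: T_def L_def rel_error_eq[OF zs])
  have D0: "ereal (?D 0) \<le> Dist_opt K A c e ip (c \<bullet> p 0)"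
    unfolding run(2) using p0 by (intro dist_opt_le_Dist_opt) auto
  have "0 \<le> ?D 0" unfolding run(2) by (rule dist_opt_nonneg[OF p0(1) z0])
  moreover have "Dist_opt K A c e ip (c \<bullet> p 0) \<noteq> \<infinity>"
  proof
    assume "Dist_opt K A c e ip (c \<bullet> p 0) = \<infinity>"
    then show False using large M T by (simp add: power2_eq_square)
  qed
  ultimately obtain Dm where Dm: "Dist_opt K A c e ip (c \<bullet> p 0) = ereal Dm"
    using D0 by (cases "Dist_opt K A c e ip (c \<bullet> p 0)") auto
  have D_sq: "(?D k)\<^sup>2 \<le> Dm\<^sup>2" if "k \<le> l" "x k \<in> K" for k
  proof -
    have xk: "x k \<in> A" "c \<bullet> x k \<le> c \<bullet> p 0" using inv[OF that(1)] by (auto simp: run_invariant_def)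
    then have "?D k \<le> Dm" "0 \<le> ?D k"
      using dist_opt_le_Dist_opt[OF xk(1) that(2) xk(2)] dist_opt_nonneg[OF xk(1)] z0 Dm by auto
    then show ?thesis by (rule power_mono)
  qed
  have "(real l + 1) * (\<epsilon> / M\<^sup>2) \<le> Dm\<^sup>2 * (8 * log (4 / 3) ((1 - \<epsilon>) / rel_descent (x 0)) + 8 + 4 / \<epsilon>)"
  proof (rule restart_count[where d = "\<lambda>k. (?D k)\<^sup>2"])
    show "0 < \<epsilon>" by fact
    show "0 < \<epsilon> / M\<^sup>2" using M assms(12) by simp
    show "0 < rel_descent (x 0)" using gap0 run(2) by simp
    show "(?D 0)\<^sup>2 \<le> Dm\<^sup>2" using D_sq[of 0] p0 run(2) by simp
    show "rel_descent (x k) \<le> 1 - \<epsilon>" if "k \<le> l" for k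
      using inv[OF that] by (simp add: run_invariant_def)
    show "\<epsilon> / M\<^sup>2 * step_gain \<epsilon> (rel_descent (x k)) \<le> (?D k)\<^sup>2" if "k \<le> l" for k
      using step(2)[OF inv[OF that] that] run(3)[of k] by blast
    show "(rel_descent (x (Suc k)) = rel_descent (x k) \<and>
          (?D (Suc k))\<^sup>2 + \<epsilon> / M\<^sup>2 * step_gain \<epsilon> (rel_descent (x k)) \<le> (?D k)\<^sup>2) \<or>
        (4 / 3 * rel_descent (x k) \<le> rel_descent (x (Suc k)) \<and> (?D (Suc k))\<^sup>2 \<le> Dm\<^sup>2)" if "k < l" for k
    proof -
      have k: "k \<le> l" "Suc k \<le> l" using that by auto
      obtain s where "is_supgradient K e ip (x k) s"
          "is_ip_projection ip (slice_space A c) s (g k)"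
        using run(3) by blast
      from step(3)[OF inv[OF k(1)] k(1) this err[OF k(2)]] D_sq[OF k(2)] show ?thesis by blast
    qed
  qed
  then have "(real l + 1) * (\<epsilon> / M\<^sup>2) \<le> Dm\<^sup>2 * (8 * L + 8 + 4 / \<epsilon>)"
    by (simp add: L_def run(2))
  also have "\<dots> \<le> Dm\<^sup>2 * (8 * (\<epsilon> * T))"
  proof (rule mult_left_mono)
    \<comment> \<open>The additive constant \<open>8\<close> is absorbed by the spare \<open>4 / \<epsilon>\<close> and the summand \<open>1\<close> of \<open>T\<close>.\<close>
    have "0 \<le> 8 * (\<epsilon> - 1 / 2)\<^sup>2 + 2" by simp
    then have "8 * \<epsilon> \<le> 4 + 8 * \<epsilon>\<^sup>2" by (simp add: power2_eq_square algebra_simps)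
    then have "(8 * \<epsilon>) / \<epsilon> \<le> (4 + 8 * \<epsilon>\<^sup>2) / \<epsilon>"
      using assms(12) by (intro divide_right_mono) auto
    then have "8 \<le> 4 / \<epsilon> + 8 * \<epsilon>"
      using assms(12) by (simp add: add_divide_distrib power2_eq_square)
    moreover have "\<epsilon> * T = 1 / \<epsilon> + L + \<epsilon>"
      using assms(12) by (simp add: T_def power2_eq_square distrib_left)
    ultimately show "8 * L + 8 + 4 / \<epsilon> \<le> 8 * (\<epsilon> * T)" by (simp add: add_divide_distrib)
  qed simp
  finally have "(real l + 1) * (\<epsilon> / M\<^sup>2) \<le> 8 * (M * Dm)\<^sup>2 * T * (\<epsilon> / M\<^sup>2)"
    using M by (simp add: power_mult_distrib mult_ac)
  then have "real l + 1 \<le> 8 * (M * Dm)\<^sup>2 * T"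
    using M assms(12) by (subst (asm) mult_le_cancel_right_pos) auto
  moreover have "8 * (M * Dm)\<^sup>2 * T \<le> real l"
    using large by (simp add: Dm)
  ultimately show False by linarith
qed

end
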